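(* Let $K$ be a field of characteristic zero, $S=K[x_0,x_1]$, and let $f_0\in S_{d_0}$, $f_1\in S_{d_1}$ be nonzero homogeneous polynomials such that the ideal $J=(f_0,f_1)$ has height $1$ and $d_0<d_1$. Put $B=S/(f_1)$. Then there exists $l\in S_1$ regular on $B$ such that: (1) the multiplication maps $(B/(l))_r\xrightarrow{f_0}(B/(l))_{r+d_0}$ and $(S/J)_{r+d_0-1}\xrightarrow{l}(S/J)_{r+d_0}$ are injective for all $r\le d_1-d_0-1$ and for all $r>d_1-1$; (2) the multiplication maps $(B/(l))_{p-d_0}\xrightarrow{f_0}(B/(l))_p$ and $(S/J)_{p-1}\xrightarrow{l}(S/J)_p$ are surjective for all $p\ge d_0$. In particular, $l$ is a Lefschetz element for $S/(f_0,f_1)$.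
   Context: $S$ has the standard grading and $M_p$ is the degree $p$ component of a graded module $M$. For a standard graded $K$-algebra $A$ and a homogeneous form $h\in A$ of degree $k$, $h$ is called a Lefschetz element for $A$ if for all integers $i$ the $K$-linear map $A_i\to A_{i+k}$ given by multiplication by $h$ has maximal rank (i.e. is injective or surjective); $A$ need not be Artinian. A form is regular on a module if it is a nonzerodivisor on it. *)

theory Defs
  imports "HOL-Algebra.Algebraic_Closure_Type" "HOL-Library.Extended_Nat"
begin

section \<open>Height of an ideal\<close>

definition prime_height :: "('a, 'b) ring_scheme \<Rightarrow> 'a set \<Rightarrow> enat" where
  "prime_height R P = Sup {enat n | n. \<exists>c :: nat \<Rightarrow> 'a set.
     (\<forall>i\<le>n. primeideal (c i) R) \<and> (\<forall>i<n. c i \<subset> c (Suc i)) \<and> c n = P}"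

text \<open>The unit ideal has height \<^term>\<open>\<infinity>\<close> (an infimum over the empty set).\<close>

definition ideal_height :: "('a, 'b) ring_scheme \<Rightarrow> 'a set \<Rightarrow> enat" where
  "ideal_height R I = Inf {prime_height R P | P. primeideal P R \<and> I \<subseteq> P}"


section \<open>Gradings and multiplication maps\<close>

text \<open>A grading of a ring is given by the family of its components, indexed by all integers.
  The quotient by a homogeneous ideal carries the images of these components.\<close>

definition quot_grading ::
    "('a, 'b) ring_scheme \<Rightarrow> (int \<Rightarrow> 'a set) \<Rightarrow> 'a set \<Rightarrow> int \<Rightarrow> 'a set set" where
  "quot_grading R G I n = (\<lambda>x. I +>\<^bsub>R\<^esub> x) ` G n"

definition regular_on :: "('a, 'b) ring_scheme \<Rightarrow> 'a \<Rightarrow> bool" where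
  "regular_on A h \<longleftrightarrow>
     h \<in> carrier A \<and> (\<forall>a\<in>carrier A. h \<otimes>\<^bsub>A\<^esub> a = \<zero>\<^bsub>A\<^esub> \<longrightarrow> a = \<zero>\<^bsub>A\<^esub>)"

text \<open>Injectivity and surjectivity of the multiplication map
  \<open>h : A\<^sub>i \<rightarrow> A\<^sub>j\<close>, where \<open>j = i + deg h\<close>.\<close>

definition mult_inj :: "('a, 'b) ring_scheme \<Rightarrow> (int \<Rightarrow> 'a set) \<Rightarrow> 'a \<Rightarrow> int \<Rightarrow> bool" where
  "mult_inj A G h i \<longleftrightarrow> inj_on (\<lambda>a. h \<otimes>\<^bsub>A\<^esub> a) (G i)"

definition mult_surj ::
    "('a, 'b) ring_scheme \<Rightarrow> (int \<Rightarrow> 'a set) \<Rightarrow> 'a \<Rightarrow> int \<Rightarrow> int \<Rightarrow> bool" where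
  "mult_surj A G h i j \<longleftrightarrow> (\<lambda>a. h \<otimes>\<^bsub>A\<^esub> a) ` G i = G j"

definition lefschetz_element ::
    "('a, 'b) ring_scheme \<Rightarrow> (int \<Rightarrow> 'a set) \<Rightarrow> nat \<Rightarrow> 'a \<Rightarrow> bool" where
  "lefschetz_element A G k h \<longleftrightarrow>
     h \<in> G (int k) \<and> (\<forall>i. mult_inj A G h i \<or> mult_surj A G h i (i + int k))"


section \<open>The standard graded polynomial ring in two variables\<close>

text \<open>\<open>K[x\<^sub>0, x\<^sub>1]\<close> is represented as \<open>K[x\<^sub>0][x\<^sub>1]\<close>: the coefficient of
  \<open>x\<^sub>0\<^sup>j x\<^sub>1\<^sup>i\<close> in \<open>p\<close> is \<open>coeff (coeff p i) j\<close>.\<close>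

definition poly_ring2 :: "'k::field poly poly ring" where
  "poly_ring2 = ring_of_type_algebra"

definition forms2 :: "int \<Rightarrow> 'k::field poly poly set" where
  "forms2 n = {p. \<forall>i j. Polynomial.coeff (Polynomial.coeff p i) j \<noteq> 0 \<longrightarrow> int i + int j = n}"

end

theory Submission
  imports Defs
begin

text \<open>
  Take \<open>l = x\<^sub>1 - a x\<^sub>0\<close> dividing neither \<open>f\<^sub>0\<close> nor \<open>f\<^sub>1\<close>. Modulo \<open>l\<close>, every form of degree
  \<open>n\<close> is a multiple of \<open>x\<^sub>0\<^sup>n\<close>, so \<open>C = B/(l)\<close> is \<open>K[x\<^sub>0]/(x\<^sub>0\<^bsup>d\<^sub>1\<^esup>)\<close> with \<open>f\<^sub>0\<close>
  acting as a nonzero multiple of \<open>x\<^sub>0\<^bsup>d\<^sub>0\<^esup>\<close>. Hence every form of degree at least \<open>d\<^sub>0\<close> lies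
  in \<open>(f\<^sub>0, l)\<close>, which is surjectivity both on \<open>C\<close> and on \<open>A = S/J\<close>. For injectivity on
  \<open>A\<close>, choose \<open>g\<close> with \<open>f\<^sub>1 - g f\<^sub>0 = l h\<close>. A homogeneous relation \<open>l u = s f\<^sub>0 + t f\<^sub>1\<close>
  becomes \<open>l (u - t h) = (s + t g) f\<^sub>0\<close>, so \<open>u\<close> is congruent to \<open>t h\<close> modulo \<open>f\<^sub>0\<close>. In
  low degrees \<open>t = 0\<close>; in high degrees \<open>t\<close> lies in \<open>(f\<^sub>0, l)\<close>, and \<open>l h\<close> lies in \<open>J\<close>.
\<close>

section \<open>Binary forms\<close>

lemma forms2_diff: "p \<in> forms2 n \<Longrightarrow> q \<in> forms2 n \<Longrightarrow> p - q \<in> forms2 n"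
  unfolding forms2_def by auto metis

lemma forms2_neg: "n < 0 \<Longrightarrow> p \<in> forms2 n \<Longrightarrow> p = 0"
  by (auto simp: forms2_def poly_eq_iff)

lemma forms2_mult:
  fixes p q :: "'k::field poly poly"
  assumes "p \<in> forms2 m" "q \<in> forms2 n"
  shows "p * q \<in> forms2 (m + n)"
  unfolding forms2_def
proof (intro CollectI allI impI)
  fix i j
  assume "Polynomial.coeff (Polynomial.coeff (p * q) i) j \<noteq> 0"
  then have "(\<Sum>i'\<le>i. \<Sum>j'\<le>j. Polynomial.coeff (Polynomial.coeff p i') j' *
      Polynomial.coeff (Polynomial.coeff q (i - i')) (j - j')) \<noteq> 0"
    by (simp add: Polynomial.coeff_mult coeff_sum)
  then obtain i' j' where "i' \<le> i" "j' \<le> j"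
    "Polynomial.coeff (Polynomial.coeff p i') j' *
      Polynomial.coeff (Polynomial.coeff q (i - i')) (j - j') \<noteq> 0"
    by (meson atMost_iff sum.not_neutral_contains_not_neutral)
  moreover from this have "int i' + int j' = m" "int (i - i') + int (j - j') = n"
    using assms unfolding forms2_def by fastforce+
  ultimately show "int i + int j = m + n"
    by linarith
qed

lemma forms2_x0_power: "[:Polynomial.monom c n:] \<in> forms2 (int n)"
  by (auto simp: forms2_def coeff_pCons split: nat.splits if_splits)

text \<open>The homogeneous component of degree \<open>n\<close>. The test \<open>int i <= n\<close>
  is needed because \<open>nat\<close> sends negative numbers to 0 and would otherwise keep stray
  constant terms.\<close>

definition hcomp :: "int \<Rightarrow> 'k::field poly poly \<Rightarrow> 'k poly poly" where
  "hcomp n p = (\<Sum>i\<le>Polynomial.degree p. Polynomial.monom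
     (if int i \<le> n
      then Polynomial.monom (Polynomial.coeff (Polynomial.coeff p i) (nat (n - int i))) (nat (n - int i))
      else 0) i)"

lemma coeff_hcomp:
  "Polynomial.coeff (Polynomial.coeff (hcomp n p) i) j =
     (if int i + int j = n then Polynomial.coeff (Polynomial.coeff p i) j else 0)"
proof -
  have "Polynomial.coeff (hcomp n p) i =
    (if int i \<le> n
     then Polynomial.monom (Polynomial.coeff (Polynomial.coeff p i) (nat (n - int i))) (nat (n - int i))
     else 0)"
    by (cases "i \<le> Polynomial.degree p")
      (auto simp: hcomp_def coeff_sum Polynomial.coeff_eq_0 cong: if_cong)
  then show ?thesis
    by auto
qed

lemma hcomp_forms2: "hcomp n p \<in> forms2 n"
  by (auto simp: forms2_def coeff_hcomp split: if_splits)

lemma hcomp_id: "p \<in> forms2 n \<Longrightarrow> hcomp n p = p"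
  by (auto simp: forms2_def poly_eq_iff coeff_hcomp)

lemma hcomp_add: "hcomp n (p + q) = hcomp n p + hcomp n q"
  by (auto simp: poly_eq_iff coeff_hcomp)

text \<open>A form of degree \<open>d\<close> shifts all degrees by \<open>d\<close>: a nonzero
  coefficient of \<open>f\<close> in the convolution makes the two degree conditions equivalent.
  This allows arbitrary relations to be replaced by homogeneous ones.\<close>

lemma hcomp_mult:
  fixes p f :: "'k::field poly poly"
  assumes f: "f \<in> forms2 d"
  shows "hcomp n (p * f) = hcomp (n - d) p * f"
proof -
  have "Polynomial.coeff (Polynomial.coeff (hcomp n (p * f)) i) j =
        Polynomial.coeff (Polynomial.coeff (hcomp (n - d) p * f) i) j" for i j
  proof -
    let ?f = "\<lambda>i' j'. Polynomial.coeff (Polynomial.coeff f (i - i')) (j - j')"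
    have "(if int i + int j = n then Polynomial.coeff (Polynomial.coeff p i') j' * ?f i' j' else 0)
        = Polynomial.coeff (Polynomial.coeff (hcomp (n - d) p) i') j' * ?f i' j'"
      if "i' \<le> i" "j' \<le> j" for i' j'
    proof (cases "?f i' j' = 0")
      case False
      then have "int (i - i') + int (j - j') = d"
        using f by (auto simp: forms2_def)
      then show ?thesis
        using that by (auto simp: coeff_hcomp of_nat_diff)
    qed auto
    then have "(\<Sum>i'\<le>i. \<Sum>j'\<le>j. if int i + int j = n
          then Polynomial.coeff (Polynomial.coeff p i') j' * ?f i' j' else 0) =
        (\<Sum>i'\<le>i. \<Sum>j'\<le>j. Polynomial.coeff (Polynomial.coeff (hcomp (n - d) p) i') j' * ?f i' j')"
      by (intro sum.cong) auto
    then show ?thesis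
      by (cases "int i + int j = n") (simp_all add: coeff_hcomp Polynomial.coeff_mult coeff_sum)
  qed
  then show ?thesis
    by (simp add: poly_eq_iff)
qed

text \<open>By \<open>hcomp_mult\<close>, \<open>u\<close> and its component of degree
  \<open>n - d\<close> have the same product with \<open>f\<close>, and \<open>f\<close> can be
  cancelled.\<close>

lemma forms2_mult_cancel:
  assumes "u * f \<in> forms2 n" "f \<in> forms2 d" "f \<noteq> 0"
  shows "u \<in> forms2 (n - d)"
proof -
  have "hcomp (n - d) u * f = u * f"
    using hcomp_mult[OF assms(2)] hcomp_id[OF assms(1)] by metis
  then have "hcomp (n - d) u = u"
    by (rule mult_right_cancel[OF assms(3), THEN iffD1])
  then show ?thesis
    using hcomp_forms2[of "n - d" u] by simp
qed


section \<open>Restriction to a line\<close>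

text \<open>The linear form \<open>x1 - a x0\<close>. It is monic in \<open>x1\<close> with root
  \<open>[:0, a:]\<close>, so evaluation at \<open>[:0, a:]\<close> is reduction modulo this
  form.\<close>

definition line :: "'k::field \<Rightarrow> 'k poly poly" where
  "line a = [:- [:0, a:], 1:]"

lemma line_forms2: "line a \<in> forms2 1"
  by (auto simp: forms2_def line_def coeff_pCons split: nat.splits)

lemma line_nonzero: "line a \<noteq> 0"
  by (simp add: line_def)

lemma poly_line [simp]: "poly (line a) [:0, a:] = 0"
  by (simp add: line_def)

lemma restrict_eq_0_iff: "poly p [:0, a:] = 0 \<longleftrightarrow> line a dvd p"
  by (simp add: poly_eq_0_iff_dvd line_def)

text \<open>The substitution \<open>x1 = a x0\<close> turns \<open>x0^j x1^i\<close> into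
  \<open>a^i x0^(i+j)\<close>. For negative \<open>n\<close> the form is zero, and \<open>c\<close>
  must be 0.\<close>

lemma restrict_form:
  fixes f :: "'k::field poly poly"
  assumes "f \<in> forms2 n"
  obtains c where "poly f [:0, a:] = Polynomial.monom c (nat n)"
proof
  have pow: "[:0, a:] ^ i = Polynomial.monom (a ^ i) i" for i
    by (metis monom_0 monom_Suc monom_power mult_1 One_nat_def)
  have "Polynomial.coeff (poly f [:0, a:]) k = 0" if "int k \<noteq> n" for k
  proof -
    have "Polynomial.coeff (Polynomial.coeff f i * Polynomial.monom (a ^ i) i) k = 0" for i
      using assms that
      by (subst mult.commute) (force simp: coeff_monom_mult forms2_def of_nat_diff)
    then show ?thesis
      by (simp add: poly_altdef pow coeff_sum)
  qed
  then show "poly f [:0, a:] = Polynomial.monom (Polynomial.coeff (poly f [:0, a:]) (nat n)) (nat n)"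
    by (intro poly_eqI) (auto simp: coeff_monom)
qed

text \<open>Over the domain \<open>K[x0]\<close> a nonzero polynomial in \<open>x1\<close> has
  finitely many roots, whereas characteristic zero makes \<open>K\<close> infinite.\<close>

lemma exists_transversal_line:
  fixes f :: "'k::field_char_0 poly poly"
  assumes "f \<noteq> 0"
  obtains a where "poly f [:0, a:] \<noteq> 0"
proof -
  have "finite ((\<lambda>a. [:0, a:]) -` {y. poly f y = 0})"
    using assms by (intro finite_vimageI poly_roots_finite) (auto simp: inj_def)
  then obtain a where "a \<notin> (\<lambda>a. [:0, a:]) -` {y. poly f y = 0}"
    using ex_new_if_finite[OF infinite_UNIV_char_0] by blast
  then show thesis
    using that by auto
qed

text \<open>The nonzero constants \<open>c0\<close> and \<open>c1\<close> express that
  \<open>line a\<close> divides neither form.\<close>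

locale transversal_line =
  fixes f0 f1 :: "'k::field_char_0 poly poly" and d0 d1 :: nat and a c0 c1 :: 'k
  assumes f0: "f0 \<in> forms2 (int d0)" and f1: "f1 \<in> forms2 (int d1)"
    and less: "d0 < d1"
    and c0: "c0 \<noteq> 0" "poly f0 [:0, a:] = Polynomial.monom c0 d0"
    and c1: "c1 \<noteq> 0" "poly f1 [:0, a:] = Polynomial.monom c1 d1"
begin

text \<open>On the line, \<open>y\<close> is a multiple of \<open>x0^p\<close>, hence of the
  restriction of \<open>f0\<close> since \<open>p >= d0\<close>; what remains is divisible by
  \<open>line a\<close>.\<close>

lemma form_decomp:
  assumes y: "y \<in> forms2 p" and p: "p \<ge> int d0"
  obtains x u where "x \<in> forms2 (p - int d0)" "u \<in> forms2 (p - 1)" "y = x * f0 + u * line a"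
proof -
  obtain c where c: "poly y [:0, a:] = Polynomial.monom c (nat p)"
    using restrict_form[OF y] .
  \<comment> \<open>Chosen so that \<open>x * f0\<close> and \<open>y\<close> have the same
    restriction \<open>c x0^p\<close>.\<close>
  define x where "x = [:Polynomial.monom (c / c0) (nat p - d0):]"
  have "poly (y - x * f0) [:0, a:] = 0"
    using p by (simp add: x_def c c0 mult_monom)
  then obtain u where u: "y - x * f0 = u * line a"
    unfolding restrict_eq_0_iff by (metis dvdE mult.commute)
  have x: "x \<in> forms2 (p - int d0)"
    using forms2_x0_power[of "c / c0" "nat p - d0"] p by (simp add: x_def of_nat_diff)
  have "y - x * f0 \<in> forms2 p"
    using forms2_diff[OF y] forms2_mult[OF x f0] by simp
  then have "u \<in> forms2 (p - 1)"
    unfolding u using line_forms2 line_nonzero by (rule forms2_mult_cancel)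
  then show thesis
    using that[OF x] u by (simp add: algebra_simps)
qed

text \<open>Triviality of the kernel of \<open>l\<close> on \<open>S/J\<close>, with
  \<open>n\<close> the degree of the target.\<close>

lemma line_mult_inj:
  assumes u: "u \<in> forms2 (n - 1)" and n: "n < int d1 \<or> n \<ge> int d0 + int d1"
    and J: "line a * u = s * f0 + t * f1"
  shows "\<exists>s t. u = s * f0 + t * f1"
proof -
  \<comment> \<open>The given \<open>s\<close> and \<open>t\<close> need not be homogeneous. Since
    \<open>line a * u\<close> is a form of degree \<open>n\<close>, their components of
    complementary degree satisfy the same relation.\<close>
  define s0 where "s0 = hcomp (n - int d0) s"
  define t0 where "t0 = hcomp (n - int d1) t"
  have "line a * u \<in> forms2 n"
    using forms2_mult[OF line_forms2 u] by simp
  then have J0: "line a * u = s0 * f0 + t0 * f1"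
    using J hcomp_id[of "line a * u" n] hcomp_mult[OF f0, of n s] hcomp_mult[OF f1, of n t]
    by (simp add: hcomp_add s0_def t0_def)
  \<comment> \<open>Chosen so that \<open>g * f0\<close> and \<open>f1\<close> agree on the line;
    \<open>d0 < d1\<close> keeps the exponent from being truncated.\<close>
  define g where "g = [:Polynomial.monom (c1 / c0) (d1 - d0):]"
  have "poly (f1 - g * f0) [:0, a:] = 0"
    using less by (simp add: g_def c0 c1 mult_monom)
  then obtain h where h: "f1 - g * f0 = line a * h"
    unfolding restrict_eq_0_iff by (metis dvdE)
  have "line a dvd line a * (u - t0 * h)" by simp
  also have lu: "line a * (u - t0 * h) = (s0 + t0 * g) * f0"
    using J0 h by (simp add: algebra_simps flip: h)
  \<comment> \<open>The product vanishes on the line but \<open>f0\<close> does not, so the other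
    factor does, \<open>K[x0]\<close> being a domain.\<close>
  finally have "poly (s0 + t0 * g) [:0, a:] * poly f0 [:0, a:] = 0"
    by (metis poly_mult restrict_eq_0_iff)
  then have "poly (s0 + t0 * g) [:0, a:] = 0"
    using c0 by simp
  then obtain s' where "s0 + t0 * g = line a * s'"
    unfolding restrict_eq_0_iff by (metis dvdE)
  with lu have "line a * (u - t0 * h) = line a * (s' * f0)"
    by (simp add: mult.assoc)
  then have "u - t0 * h = s' * f0"
    by (rule mult_left_cancel[OF line_nonzero, THEN iffD1])
  then have u_eq: "u = s' * f0 + t0 * h"
    by (simp add: diff_eq_eq)
  have t0: "t0 \<in> forms2 (n - int d1)"
    by (simp add: t0_def hcomp_forms2)
  from n show ?thesis
  proof
    assume "n < int d1"
    then have "t0 = 0"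
      using forms2_neg[OF _ t0] by simp
    then show ?thesis
      using u_eq by (intro exI[of _ s'] exI[of _ 0]) simp
  next
    assume "n \<ge> int d0 + int d1"
    then have "n - int d1 \<ge> int d0"
      by simp
    then obtain x v where "t0 = x * f0 + v * line a"
      by (rule form_decomp[OF t0])
    then have "t0 * h = x * h * f0 + v * (line a * h)"
      by (simp add: algebra_simps)
    then have "u = (s' + x * h - v * g) * f0 + v * f1"
      by (simp add: u_eq flip: h) (simp add: algebra_simps)
    then show ?thesis by blast
  qed
qed

text \<open>Since \<open>f1\<close> does not vanish on the line, \<open>line a\<close> must divide
  \<open>s\<close> and can be cancelled. This gives regularity on \<open>B\<close>.\<close>

lemma line_regular:
  assumes "line a * u = s * f1"
  obtains s' where "u = s' * f1"
proof -
  have "poly s [:0, a:] * poly f1 [:0, a:] = 0"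
    using assms by (metis poly_mult poly_line mult_zero_left)
  then have "line a dvd s"
    using c1 by (simp flip: restrict_eq_0_iff)
  then obtain s' where "s = line a * s'" ..
  with assms have "line a * u = line a * (s' * f1)"
    by (simp add: mult.assoc)
  then show thesis
    using that[of s'] line_nonzero[of a] by simp
qed

text \<open>In \<open>K[x0]/(x0^d1)\<close> the element \<open>x\<close> is \<open>c x0^r\<close>.
  If \<open>r + d0 < d1\<close>, its product with \<open>c0 x0^d0\<close> vanishes only for
  \<open>c = 0\<close>; if \<open>r >= d1\<close>, \<open>x\<close> is already zero there.\<close>

lemma f0_mult_inj:
  assumes x: "x \<in> forms2 r" and r: "r < int d1 - int d0 \<or> r \<ge> int d1"
    and eq: "f0 * x = s * f1 + t * line a"
  shows "\<exists>s t. x = s * f1 + t * line a"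
proof (cases "r < 0")
  case True
  then show ?thesis
    using forms2_neg[OF _ x] by (intro exI[of _ 0]) simp
next
  case False
  obtain c where c: "poly x [:0, a:] = Polynomial.monom c (nat r)"
    using restrict_form[OF x] .
  have eq': "Polynomial.monom (c0 * c) (d0 + nat r) = poly s [:0, a:] * Polynomial.monom c1 d1"
    using arg_cong[OF eq, of "\<lambda>p. poly p [:0, a:]"] c c0 c1 by (simp add: mult_monom)
  \<comment> \<open>\<open>g * f1\<close> has to match \<open>x\<close> on the line: in low degrees
    both restrict to zero, in high degrees \<open>c x0^r\<close> is divisible by
    \<open>c1 x0^d1\<close>.\<close>
  define g where "g = (if r < int d1 then 0 else [:Polynomial.monom (c / c1) (nat r - d1):])"
  have "poly (x - g * f1) [:0, a:] = 0"
  proof (cases "r < int d1")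
    case True
    \<comment> \<open>The right side of \<open>eq'\<close> is divisible by \<open>x0^d1\<close>, so
      its coefficient at \<open>d0 + r < d1\<close> is zero.\<close>
    then have "c0 * c = 0"
      using arg_cong[OF eq', of "\<lambda>p. Polynomial.coeff p (d0 + nat r)"] r False
      by (simp add: coeff_monom_mult mult.commute[of "poly s _"])
    then show ?thesis
      using True c0 by (simp add: g_def c)
  next
    case False
    then show ?thesis
      by (simp add: g_def c c1 mult_monom)
  qed
  then obtain t' where "x - g * f1 = line a * t'"
    unfolding restrict_eq_0_iff by (metis dvdE)
  then have "x = g * f1 + t' * line a"
    by (simp add: algebra_simps)
  then show ?thesis by blast
qed

end


section \<open>Cosets in quotient rings\<close>

lemma poly_ring2_simps [simp]:
  "carrier poly_ring2 = UNIV" "x \<otimes>\<^bsub>poly_ring2\<^esub> y = x * y" "x \<oplus>\<^bsub>poly_ring2\<^esub> y = x + y"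
  "\<zero>\<^bsub>poly_ring2\<^esub> = 0" "\<one>\<^bsub>poly_ring2\<^esub> = 1"
  by (simp_all add: poly_ring2_def ring_of_type_algebra_def)

lemma cring_poly_ring2: "cring poly_ring2"
  unfolding poly_ring2_def by (rule cring_from_type_algebra)

lemma minus_poly_ring2 [simp]: "x \<ominus>\<^bsub>poly_ring2\<^esub> y = x - y"
proof -
  interpret cring poly_ring2 by (rule cring_poly_ring2)
  have "x \<ominus>\<^bsub>poly_ring2\<^esub> y \<oplus>\<^bsub>poly_ring2\<^esub> y = x"
    using minus_eq[of x y] l_neg[of y] a_assoc[of x _ y] a_inv_closed[of y] by simp
  then show ?thesis
    by (simp add: eq_diff_eq)
qed

lemma (in cring) genideal_singleton:
  assumes "x \<in> carrier R"
  shows "Idl {x} = (\<lambda>s. s \<otimes> x) ` carrier R"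
  using cgenideal_eq_genideal[OF assms] by (auto simp: cgenideal_def)

lemma genideal_poly_ring2_1: "Idl\<^bsub>poly_ring2\<^esub> {f} = {s * f | s. True}"
  using cring.genideal_singleton[OF cring_poly_ring2, of f] by auto

text \<open>The right side is the sum of two principal ideals, hence an ideal containing both
  generators; minimality gives one inclusion.\<close>

lemma genideal_poly_ring2_2:
  "Idl\<^bsub>poly_ring2\<^esub> {f, g} = {s * f + t * g | s t. True}" (is "?L = ?R")
proof
  interpret cring poly_ring2 by (rule cring_poly_ring2)
  have R: "?R = Idl\<^bsub>poly_ring2\<^esub> {f} <+>\<^bsub>poly_ring2\<^esub> Idl\<^bsub>poly_ring2\<^esub> {g}"
    by (auto simp: genideal_poly_ring2_1 set_add_def' set_eq_iff)
  have "ideal ?R poly_ring2"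
    unfolding R by (intro add_ideals genideal_ideal) auto
  moreover have "f = 1 * f + 0 * g" "g = 0 * f + 1 * g"
    by simp_all
  then have "{f, g} \<subseteq> ?R"
    by blast
  ultimately show "?L \<subseteq> ?R"
    by (rule genideal_minimal)
  interpret L: ideal ?L poly_ring2
    by (rule genideal_ideal) auto
  have fg: "f \<in> ?L" "g \<in> ?L"
    using genideal_self[of "{f, g}"] by auto
  show "?R \<subseteq> ?L"
    using L.a_closed[OF L.I_l_closed[OF fg(1)] L.I_l_closed[OF fg(2)]] by auto
qed

context
  fixes I :: "'k::field poly poly set"
  assumes I: "ideal I poly_ring2"
begin

interpretation cring poly_ring2 by (rule cring_poly_ring2)
interpretation ideal I poly_ring2 by (rule I)

lemma quot_poly_ring2_eq_iff: "I +>\<^bsub>poly_ring2\<^esub> x = I +>\<^bsub>poly_ring2\<^esub> y \<longleftrightarrow> x - y \<in> I"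
  using quotient_eq_iff_same_a_r_cos[OF I, of x y] by simp

lemma quot_poly_ring2_mult:
  "(I +>\<^bsub>poly_ring2\<^esub> x) \<otimes>\<^bsub>poly_ring2 Quot I\<^esub> (I +>\<^bsub>poly_ring2\<^esub> y) = I +>\<^bsub>poly_ring2\<^esub> (x * y)"
  using ring_hom_mult[OF rcos_ring_hom, of x y] by simp

lemma quot_poly_ring2_minus:
  "(I +>\<^bsub>poly_ring2\<^esub> x) \<ominus>\<^bsub>poly_ring2 Quot I\<^esub> (I +>\<^bsub>poly_ring2\<^esub> y) = I +>\<^bsub>poly_ring2\<^esub> (x - y)"
proof -
  interpret h: ring_hom_ring poly_ring2 "poly_ring2 Quot I" "(+>\<^bsub>poly_ring2\<^esub>) I"
    by (rule rcos_ring_hom_ring)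
  show ?thesis
    by (simp add: a_minus_def h.hom_add h.hom_a_inv flip: minus_poly_ring2 del: poly_ring2_simps(3))
qed

lemma quot_poly_ring2_carrier: "carrier (poly_ring2 Quot I) = range (\<lambda>x. I +>\<^bsub>poly_ring2\<^esub> x)"
  by (auto simp: FactRing_def A_RCOSETS_def')

lemma quot_poly_ring2_zero: "\<zero>\<^bsub>poly_ring2 Quot I\<^esub> = I +>\<^bsub>poly_ring2\<^esub> 0"
  using a_rcos_const[OF zero_closed] by (simp add: FactRing_def)

lemma quot_poly_ring2_principal:
  "Idl\<^bsub>poly_ring2 Quot I\<^esub> {I +>\<^bsub>poly_ring2\<^esub> l} = {I +>\<^bsub>poly_ring2\<^esub> (t * l) | t. True}"
proof -
  interpret B: cring "poly_ring2 Quot I"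
    by (rule quotient_is_cring) (rule cring_axioms)
  show ?thesis
    by (subst B.genideal_singleton)
      (auto simp: quot_poly_ring2_carrier quot_poly_ring2_mult image_image full_SetCompr_eq)
qed

text \<open>Equality in the iterated quotient \<open>B/(l)\<close> is pulled back to congruence
  modulo \<open>I + (l)\<close> in the polynomial ring, where the line lemmas apply.\<close>

lemma double_quot_poly_ring2:
  fixes l defines "B \<equiv> poly_ring2 Quot I"
    and "L \<equiv> Idl\<^bsub>poly_ring2 Quot I\<^esub> {I +>\<^bsub>poly_ring2\<^esub> l}"
  shows double_quot_poly_ring2_eq_iff:
      "L +>\<^bsub>B\<^esub> (I +>\<^bsub>poly_ring2\<^esub> x) = L +>\<^bsub>B\<^esub> (I +>\<^bsub>poly_ring2\<^esub> y) \<longleftrightarrow>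
        (\<exists>t. x - y - t * l \<in> I)"
    and double_quot_poly_ring2_mult:
      "(L +>\<^bsub>B\<^esub> (I +>\<^bsub>poly_ring2\<^esub> x)) \<otimes>\<^bsub>B Quot L\<^esub> (L +>\<^bsub>B\<^esub> (I +>\<^bsub>poly_ring2\<^esub> y)) =
        L +>\<^bsub>B\<^esub> (I +>\<^bsub>poly_ring2\<^esub> (x * y))"
proof -
  interpret B: cring B
    unfolding B_def by (rule quotient_is_cring) (rule cring_axioms)
  have carr: "I +>\<^bsub>poly_ring2\<^esub> z \<in> carrier B" for z
    by (auto simp: B_def quot_poly_ring2_carrier)
  interpret L: ideal L B
    unfolding L_def B_def[symmetric] using carr by (intro B.genideal_ideal) auto
  show "L +>\<^bsub>B\<^esub> (I +>\<^bsub>poly_ring2\<^esub> x) = L +>\<^bsub>B\<^esub> (I +>\<^bsub>poly_ring2\<^esub> y) \<longleftrightarrow>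
      (\<exists>t. x - y - t * l \<in> I)"
    by (subst B.quotient_eq_iff_same_a_r_cos[OF L.ideal_axioms carr carr, symmetric])
      (auto simp: B_def L_def quot_poly_ring2_minus quot_poly_ring2_principal quot_poly_ring2_eq_iff)
  show "(L +>\<^bsub>B\<^esub> (I +>\<^bsub>poly_ring2\<^esub> x)) \<otimes>\<^bsub>B Quot L\<^esub> (L +>\<^bsub>B\<^esub> (I +>\<^bsub>poly_ring2\<^esub> y)) =
      L +>\<^bsub>B\<^esub> (I +>\<^bsub>poly_ring2\<^esub> (x * y))"
    using ring_hom_mult[OF L.rcos_ring_hom carr carr, of x y]
    by (simp add: B_def quot_poly_ring2_mult)
qed

end


section \<open>The Lefschetz property\<close>

theorem corollary2p9:
  fixes f0 f1 :: "'k::field_char_0 poly poly" and d0 d1 :: nat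
  assumes "f0 \<in> forms2 (int d0)" "f0 \<noteq> 0"
    and "f1 \<in> forms2 (int d1)" "f1 \<noteq> 0"
    and "ideal_height poly_ring2 (Idl\<^bsub>poly_ring2\<^esub> {f0, f1}) = 1"
    and "d0 < d1"
  shows
    "let S = poly_ring2;
         J = Idl\<^bsub>S\<^esub> {f0, f1};
         A = S Quot J;
         gradA = quot_grading S forms2 J;
         I = Idl\<^bsub>S\<^esub> {f1};
         B = S Quot I;
         gradB = quot_grading S forms2 I
     in \<exists>l\<in>forms2 1.
          let lA = J +>\<^bsub>S\<^esub> l;
              lB = I +>\<^bsub>S\<^esub> l;
              L = Idl\<^bsub>B\<^esub> {lB};
              C = B Quot L;
              gradC = quot_grading B gradB L;
              f0C = L +>\<^bsub>B\<^esub> (I +>\<^bsub>S\<^esub> f0)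
          in regular_on B lB
           \<and> (\<forall>r::int. r \<le> int d1 - int d0 - 1 \<or> r > int d1 - 1 \<longrightarrow>
                 mult_inj C gradC f0C r \<and> mult_inj A gradA lA (r + int d0 - 1))
           \<and> (\<forall>p::int. p \<ge> int d0 \<longrightarrow>
                 mult_surj C gradC f0C (p - int d0) p \<and> mult_surj A gradA lA (p - 1) p)
           \<and> lefschetz_element A gradA 1 lA"
proof -
  interpret S: cring poly_ring2 by (rule cring_poly_ring2)
  \<comment> \<open>Applied to the product, the lemma yields one \<open>a\<close> on whose line
    neither form vanishes.\<close>
  obtain a where a: "poly (f0 * f1) [:0, a:] \<noteq> 0"
    using exists_transversal_line[of "f0 * f1"] assms by auto
  obtain c0 where c0: "poly f0 [:0, a:] = Polynomial.monom c0 d0"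
    using restrict_form[OF assms(1)] by auto
  obtain c1 where c1: "poly f1 [:0, a:] = Polynomial.monom c1 d1"
    using restrict_form[OF assms(3)] by auto
  interpret transversal_line f0 f1 d0 d1 a c0 c1
    using assms a c0 c1 by unfold_locales auto

  define S where "S = (poly_ring2 :: 'k poly poly ring)"
  define l where "l = line a"
  define J where "J = Idl\<^bsub>S\<^esub> {f0, f1}"
  define I where "I = Idl\<^bsub>S\<^esub> {f1}"
  define B where "B = S Quot I"
  define L where "L = Idl\<^bsub>B\<^esub> {I +>\<^bsub>S\<^esub> l}"
  have J: "ideal J S" and I: "ideal I S"
    unfolding J_def I_def S_def by (rule S.genideal_ideal; simp)+
  have memJ: "x \<in> J \<longleftrightarrow> (\<exists>s t. x = s * f0 + t * f1)" for x
    by (simp add: J_def S_def genideal_poly_ring2_2)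
  have memI: "x \<in> I \<longleftrightarrow> (\<exists>s. x = s * f1)" for x
    by (simp add: I_def S_def genideal_poly_ring2_1)
  note quotJ = quot_poly_ring2_eq_iff[OF J[unfolded S_def], folded S_def]
    quot_poly_ring2_mult[OF J[unfolded S_def], folded S_def]
  note quotI = quot_poly_ring2_eq_iff[OF I[unfolded S_def], folded S_def]
    quot_poly_ring2_mult[OF I[unfolded S_def], folded S_def]
    quot_poly_ring2_zero[OF I[unfolded S_def], folded S_def]
    quot_poly_ring2_carrier[OF I[unfolded S_def], folded S_def]
  have eqC: "L +>\<^bsub>B\<^esub> (I +>\<^bsub>S\<^esub> x) = L +>\<^bsub>B\<^esub> (I +>\<^bsub>S\<^esub> y) \<longleftrightarrow>
      (\<exists>s t. x - y = s * f1 + t * l)" for x y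
    using double_quot_poly_ring2_eq_iff[OF I[unfolded S_def], folded S_def, of l x y]
    by (simp add: B_def L_def memI diff_eq_eq) (metis add.assoc add.commute)
  note multC = double_quot_poly_ring2_mult[OF I[unfolded S_def], folded S_def, of l, folded B_def, folded L_def]

  have injA: "mult_inj (S Quot J) (quot_grading S forms2 J) (J +>\<^bsub>S\<^esub> l) (n - 1)"
    if n: "n < int d1 \<or> n \<ge> int d0 + int d1" for n
    unfolding mult_inj_def quot_grading_def
  proof (rule inj_onI, clarsimp simp: quotJ)
    fix x y
    assume "x \<in> forms2 (n - 1)" "y \<in> forms2 (n - 1)" "l * x - l * y \<in> J"
    moreover from this obtain s t where "line a * (x - y) = s * f0 + t * f1"
      by (auto simp: memJ l_def algebra_simps)
    ultimately show "x - y \<in> J"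
      using line_mult_inj[OF forms2_diff n] by (simp add: memJ)
  qed

  have surjA: "mult_surj (S Quot J) (quot_grading S forms2 J) (J +>\<^bsub>S\<^esub> l) (p - 1) p"
    if p: "p \<ge> int d0" for p
    unfolding mult_surj_def quot_grading_def image_image quotJ
  \<comment> \<open>One inclusion is additivity of degrees; the other is \<open>form_decomp\<close>,
    whose \<open>f0\<close> term vanishes modulo \<open>J\<close>.\<close>
  proof (intro equalityI subsetI; elim imageE; simp only:)
    fix u :: "'k poly poly"
    assume "u \<in> forms2 (p - 1)"
    then show "J +>\<^bsub>S\<^esub> (l * u) \<in> (\<lambda>x. J +>\<^bsub>S\<^esub> x) ` forms2 p"
      using forms2_mult[OF line_forms2[of a], of u "p - 1"] by (simp add: l_def)
  next
    fix y :: "'k poly poly"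
    assume y: "y \<in> forms2 p"
    obtain x u where xu: "u \<in> forms2 (p - 1)" "y = x * f0 + u * line a"
      using y p by (rule form_decomp)
    have "y - l * u = x * f0 + 0 * f1"
      using xu by (simp add: l_def algebra_simps)
    then have "J +>\<^bsub>S\<^esub> y = J +>\<^bsub>S\<^esub> (l * u)"
      unfolding quotJ memJ by blast
    then show "J +>\<^bsub>S\<^esub> y \<in> (\<lambda>u. J +>\<^bsub>S\<^esub> (l * u)) ` forms2 (p - 1)"
      using xu by blast
  qed

  have injC: "mult_inj (B Quot L) (quot_grading B (quot_grading S forms2 I) L)
      (L +>\<^bsub>B\<^esub> (I +>\<^bsub>S\<^esub> f0)) r"
    if r: "r < int d1 - int d0 \<or> r \<ge> int d1" for r
    unfolding mult_inj_def quot_grading_def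
  proof (rule inj_onI, clarsimp simp: multC)
    fix x y
    assume xy: "x \<in> forms2 r" "y \<in> forms2 r"
      and "L +>\<^bsub>B\<^esub> (I +>\<^bsub>S\<^esub> (f0 * x)) = L +>\<^bsub>B\<^esub> (I +>\<^bsub>S\<^esub> (f0 * y))"
    then obtain s t where "f0 * (x - y) = s * f1 + t * line a"
      by (auto simp: eqC l_def algebra_simps)
    then show "L +>\<^bsub>B\<^esub> (I +>\<^bsub>S\<^esub> x) = L +>\<^bsub>B\<^esub> (I +>\<^bsub>S\<^esub> y)"
      using f0_mult_inj[OF forms2_diff[OF xy] r] by (simp add: eqC l_def)
  qed

  have surjC: "mult_surj (B Quot L) (quot_grading B (quot_grading S forms2 I) L)
      (L +>\<^bsub>B\<^esub> (I +>\<^bsub>S\<^esub> f0)) (p - int d0) p"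
    if p: "p \<ge> int d0" for p
    unfolding mult_surj_def quot_grading_def image_image multC
  \<comment> \<open>As for \<open>surjA\<close>, except that now the \<open>line a\<close> term of
    \<open>form_decomp\<close> vanishes.\<close>
  proof (intro equalityI subsetI; elim imageE; simp only:)
    fix x :: "'k poly poly"
    assume "x \<in> forms2 (p - int d0)"
    then show "L +>\<^bsub>B\<^esub> (I +>\<^bsub>S\<^esub> (f0 * x)) \<in> (\<lambda>x. L +>\<^bsub>B\<^esub> (I +>\<^bsub>S\<^esub> x)) ` forms2 p"
      using forms2_mult[OF f0, of x "p - int d0"] by simp
  next
    fix y :: "'k poly poly"
    assume y: "y \<in> forms2 p"
    obtain x u where xu: "x \<in> forms2 (p - int d0)" "y = x * f0 + u * line a"
      using y p by (rule form_decomp)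
    have "y - f0 * x = 0 * f1 + u * l"
      using xu by (simp add: l_def algebra_simps)
    then have "L +>\<^bsub>B\<^esub> (I +>\<^bsub>S\<^esub> y) = L +>\<^bsub>B\<^esub> (I +>\<^bsub>S\<^esub> (f0 * x))"
      unfolding eqC by blast
    then show "L +>\<^bsub>B\<^esub> (I +>\<^bsub>S\<^esub> y) \<in>
        (\<lambda>x. L +>\<^bsub>B\<^esub> (I +>\<^bsub>S\<^esub> (f0 * x))) ` forms2 (p - int d0)"
      using xu by blast
  qed

  have reg: "regular_on B (I +>\<^bsub>S\<^esub> l)"
    unfolding regular_on_def
  proof (intro conjI ballI impI)
    show "I +>\<^bsub>S\<^esub> l \<in> carrier B"
      unfolding B_def quotI(4) by blast
    fix b assume "b \<in> carrier B" and b: "(I +>\<^bsub>S\<^esub> l) \<otimes>\<^bsub>B\<^esub> b = \<zero>\<^bsub>B\<^esub>"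
    then obtain x where x: "b = I +>\<^bsub>S\<^esub> x"
      by (auto simp: B_def quotI)
    with b obtain s where "line a * x = s * f1"
      by (auto simp: B_def quotI memI l_def)
    then show "b = \<zero>\<^bsub>B\<^esub>"
      using line_regular by (metis B_def quotI(1,3) memI diff_zero x)
  qed

  have lefschetz: "lefschetz_element (S Quot J) (quot_grading S forms2 J) 1 (J +>\<^bsub>S\<^esub> l)"
    unfolding lefschetz_element_def
  proof (intro conjI allI)
    show "J +>\<^bsub>S\<^esub> l \<in> quot_grading S forms2 J (int 1)"
      using line_forms2 by (auto simp: quot_grading_def l_def)
    fix i :: int
    \<comment> \<open>The two ranges cover all degrees: if \<open>i + 1 < d1\<close> the map is
      injective, otherwise \<open>i + 1 >= d1 > d0\<close> and it is surjective.\<close>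
    show "mult_inj (S Quot J) (quot_grading S forms2 J) (J +>\<^bsub>S\<^esub> l) i \<or>
        mult_surj (S Quot J) (quot_grading S forms2 J) (J +>\<^bsub>S\<^esub> l) i (i + int 1)"
      using injA[of "i + 1"] surjA[of "i + 1"] less by (cases "i + 1 < int d1") auto
  qed

  \<comment> \<open>With target degree \<open>n = r + d0\<close> on \<open>S/J\<close>, the two
    ranges of \<open>r\<close> become \<open>n < d1\<close> and \<open>n >= d0 + d1\<close>, as in
    \<open>injA\<close>.\<close>
  have "mult_inj (B Quot L) (quot_grading B (quot_grading S forms2 I) L)
          (L +>\<^bsub>B\<^esub> (I +>\<^bsub>S\<^esub> f0)) r \<and>
        mult_inj (S Quot J) (quot_grading S forms2 J) (J +>\<^bsub>S\<^esub> l) (r + int d0 - 1)"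
    if "r \<le> int d1 - int d0 - 1 \<or> r > int d1 - 1" for r
    using injC[of r] injA[of "r + int d0"] that by auto
  moreover have "l \<in> forms2 1"
    by (simp add: l_def line_forms2)
  ultimately show ?thesis
    using reg surjA surjC lefschetz
    unfolding Let_def S_def[symmetric] J_def[symmetric] I_def[symmetric] B_def[symmetric]
    by (intro bexI[of _ l]) (auto simp: L_def)
qed

end
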